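(* Let $n$ be even, let $z\in\{\pm1\}^n$ with $\langle z,\mathbf{1}\rangle=0$, let $0\le q<p\le 1$, and let $A$ be the adjacency matrix of a graph on $\{1,\dots,n\}$ (a realization of the stochastic block model with label vector $z$ and parameters $p,q$), with $$\mathbf{E} A = \frac{p-q}{2}zz^\top + \frac{p+q}{2}\mathbf{1}\mathbf{1}^\top - pI_n.$$ For $i=1,\dots,n$ let $$d^z_i = z_i\sum_{\substack{j=1\\ j\neq i}}^n A_{ij}z_j,\qquad d^z_{\min} = \min_{1\le i\le n} d^z_i.$$ Let $r\geq 4$ be an integer, and suppose one of the following holds: (1) the cost matrix is $C = A - \frac{1}{n^2}\langle A,\mathbf{1}\mathbf{1}^\top\rangle\mathbf{1}\mathbf{1}^\top$ and $$d^z_{\min}\geq\frac{r+11}{r-3}\left(2\lVert A-\mathbf{E}A\rVert_{\mathrm{op}}+p\right)+\frac{n(p-q)}{r-1};$$ (2) the cost matrix is $C = A-\frac{p+q}{2}\mathbf{1}\mathbf{1}^\top$ and $$d^z_{\min}\geq\frac{r+11}{r-3}\lVert A-\mathbf{E}A\rVert_{\mathrm{op}}+\frac{n(p-q)}{r-1}.$$ Then every second-order critical point $Y\in\mathbf{R}^{n\times r}$ of the problem $$\max_{Y \in \mathbf{R}^{n\times r}}~\langle C, YY^\top\rangle \quad \text{s.t. } \mathrm{ddiag}(YY^\top) = I_n$$ satisfies $Y = zu^\top$ for some unit-norm $u\in\mathbf{R}^r$.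
   Context: The stochastic block model with balanced label vector $z$ and parameters $p,q$: $A$ is a symmetric $0/1$ matrix with zero diagonal whose entries $A_{ij}$, $i<j$, are independent with $\mathbf{P}(A_{ij}=1)=p$ if $z_i=z_j$ and $\mathbf{P}(A_{ij}=1)=q$ if $z_i\ne z_j$. The result is deterministic: it holds for every realization $A$ satisfying (1) or (2), where $\mathbf{E}A$ denotes the fixed matrix displayed in the statement (the expectation of $A$ under the model). $\mathbf{1}$ is the all-ones vector in $\mathbf{R}^n$; $\lVert\cdot\rVert_{\mathrm{op}}$ is the $\ell_2$ operator norm. $\langle \cdot,\cdot\rangle$ is the Euclidean inner product for vectors and the Frobenius inner product $\langle A,B\rangle = \mathrm{trace}(A^\top B)$ for matrices; $\mathrm{ddiag}\colon \mathbf{R}^{n\times n}\to\mathbf{R}^{n\times n}$ keeps the diagonal of a matrix and sets the off-diagonal entries to zero. The constraint $\mathrm{ddiag}(YY^\top)=I_n$ says that every row of $Y$ is a unit vector in $\mathbf{R}^r$, so the feasible set is a Riemannian manifold (a product of $n$ unit spheres embedded in $\mathbf{R}^r$). A second-order critical point is a feasible $Y$ at which the Riemannian gradient of the objective is zero and the Riemannian Hessian is negative semidefinite. Explicitly, for symmetric $C$, put $S(Y) = \mathrm{ddiag}(CYY^\top) - C$; a feasible $Y$ is second-order critical if and only if (i) $S(Y)Y = 0$, and (ii) $\langle S(Y), \dot Y \dot Y^\top\rangle \ge 0$ for every $\dot Y\in\mathbf{R}^{n\times r}$ such that $\mathrm{ddiag}(Y\dot Y^\top)=0$. *)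

theory Defs
  imports "HOL-Analysis.Analysis"
begin

section \<open>Matrix notation\<close>

text \<open>
  An \<open>n \<times> r\<close> real matrix is an element of \<^typ>\<open>real^'r^'n\<close>.  The library inner product
  on this type is the Frobenius inner product, see \<open>inner_matrix_eq_trace\<close> below.
\<close>

definition outer :: "real^'n \<Rightarrow> real^'m \<Rightarrow> real^'m^'n" where
  "outer v w = (\<chi> i j. v $ i * w $ j)"

definition ddiag :: "real^'n^'n \<Rightarrow> real^'n^'n" where
  "ddiag M = (\<chi> i j. if i = j then M $ i $ j else 0)"

definition op_norm :: "real^'m^'n \<Rightarrow> real" where
  "op_norm M = onorm (\<lambda>v. M *v v)"

section \<open>The stochastic block model data\<close>

definition adjacency_matrix :: "real^'n^'n \<Rightarrow> bool" where
  "adjacency_matrix A \<longleftrightarrow>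
     (\<forall>i j. A $ i $ j = 0 \<or> A $ i $ j = 1) \<and> transpose A = A \<and> (\<forall>i. A $ i $ i = 0)"

text \<open>
  The expectation of the adjacency matrix under the model: \<open>p\<close> between distinct vertices with
  equal labels, \<open>q\<close> between vertices with different labels, and \<open>0\<close> on the diagonal.
\<close>

definition sbm_mean :: "real \<Rightarrow> real \<Rightarrow> real^'n \<Rightarrow> real^'n^'n" where
  "sbm_mean p q z =
     ((p - q) / 2) *\<^sub>R outer z z + ((p + q) / 2) *\<^sub>R outer 1 1 - p *\<^sub>R mat 1"

definition label_degree :: "real^'n^'n \<Rightarrow> real^'n \<Rightarrow> 'n \<Rightarrow> real" where
  "label_degree A z i = z $ i * (\<Sum>j\<in>UNIV - {i}. A $ i $ j * z $ j)"

definition min_label_degree :: "real^'n^'n \<Rightarrow> real^'n \<Rightarrow> real" where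
  "min_label_degree A z = Min (range (label_degree A z))"

section \<open>Second-order critical points\<close>

definition objective :: "real^'n^'n \<Rightarrow> real^'r^'n \<Rightarrow> real" where
  "objective C Y = C \<bullet> (Y ** transpose Y)"

definition feasible :: "real^'r^'n \<Rightarrow> bool" where
  "feasible Y \<longleftrightarrow> ddiag (Y ** transpose Y) = mat 1"

definition tangent_space :: "real^'r^'n \<Rightarrow> (real^'r^'n) set" where
  "tangent_space Y = {V. ddiag (Y ** transpose V) = 0}"

text \<open>
  For feasible \<open>Y\<close> this is the orthogonal projection of \<open>Z\<close> onto the tangent space at \<open>Y\<close>;
  see \<open>tangent_proj_mem\<close> and \<open>tangent_proj_orthogonal\<close>.
\<close>

definition tangent_proj :: "real^'r^'n \<Rightarrow> real^'r^'n \<Rightarrow> real^'r^'n" where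
  "tangent_proj Y Z = Z - ddiag (Z ** transpose Y) ** Y"

definition euclidean_grad :: "(real^'r^'n \<Rightarrow> real) \<Rightarrow> real^'r^'n \<Rightarrow> real^'r^'n" where
  "euclidean_grad f Y = (THE G. GDERIV f Y :> G)"

text \<open>
  The manifold of feasible points is a Riemannian submanifold of the Euclidean space of
  matrices.  The Riemannian gradient is the tangential part of the Euclidean gradient, and the
  Riemannian Hessian is the tangential part of the derivative of (a smooth extension of) the
  Riemannian gradient.  The function \<open>riem_grad f\<close>, being defined on all matrices, serves as
  the extension.
\<close>

definition riem_grad :: "(real^'r^'n \<Rightarrow> real) \<Rightarrow> real^'r^'n \<Rightarrow> real^'r^'n" where
  "riem_grad f Y = tangent_proj Y (euclidean_grad f Y)"

definition riem_hess :: "(real^'r^'n \<Rightarrow> real) \<Rightarrow> real^'r^'n \<Rightarrow> real^'r^'n \<Rightarrow> real^'r^'n" where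
  "riem_hess f Y V = tangent_proj Y (frechet_derivative (riem_grad f) (at Y) V)"

definition second_order_critical :: "real^'n^'n \<Rightarrow> real^'r^'n \<Rightarrow> bool" where
  "second_order_critical C Y \<longleftrightarrow>
     feasible Y \<and>
     riem_grad (objective C) Y = 0 \<and>
     (\<forall>V \<in> tangent_space Y. V \<bullet> riem_hess (objective C) Y V \<le> 0)"

section \<open>The explicit form of the second-order conditions\<close>

definition cert_matrix :: "real^'n^'n \<Rightarrow> real^'r^'n \<Rightarrow> real^'n^'n" where
  "cert_matrix C Y = ddiag (C ** Y ** transpose Y) - C"

lemma inner_matrix_eq_trace:
  fixes A B :: "real^'m^'n"
  shows "A \<bullet> B = trace (transpose A ** B)"
proof -
  have "A \<bullet> B = (\<Sum>i\<in>UNIV. \<Sum>j\<in>UNIV. A $ i $ j * B $ i $ j)"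
    by (simp add: inner_vec_def)
  also have "\<dots> = (\<Sum>j\<in>UNIV. \<Sum>i\<in>UNIV. A $ i $ j * B $ i $ j)"
    by (rule sum.swap)
  finally show ?thesis
    by (simp add: trace_def matrix_matrix_mult_def transpose_def)
qed

lemma inner_transpose:
  fixes A B :: "real^'m^'n"
  shows "transpose A \<bullet> transpose B = A \<bullet> B"
  unfolding inner_vec_def transpose_def by (simp, rule sum.swap)

lemma inner_mult_left:
  fixes A :: "real^'m^'n" and B :: "real^'k^'m" and D :: "real^'k^'n"
  shows "(A ** B) \<bullet> D = B \<bullet> (transpose A ** D)"
  by (simp add: inner_matrix_eq_trace matrix_transpose_mul matrix_mul_assoc)

lemma inner_mult_right:
  fixes A :: "real^'m^'n" and B :: "real^'k^'m" and D :: "real^'k^'n"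
  shows "(A ** B) \<bullet> D = A \<bullet> (D ** transpose B)"
proof -
  have "(A ** B) \<bullet> D = (transpose B ** transpose A) \<bullet> transpose D"
    by (metis inner_transpose matrix_transpose_mul)
  also have "\<dots> = transpose A \<bullet> (B ** transpose D)"
    by (simp add: inner_mult_left)
  also have "\<dots> = A \<bullet> (D ** transpose B)"
    by (metis inner_transpose matrix_transpose_mul transpose_transpose)
  finally show ?thesis .
qed

lemma ddiag_inner:
  fixes M N :: "real^'n^'n"
  shows "ddiag M \<bullet> N = M \<bullet> ddiag N"
  by (simp add: inner_vec_def ddiag_def if_distrib if_distribR cong: if_cong)

lemma ddiag_transpose: "ddiag (transpose M) = ddiag M"
  by (simp add: ddiag_def transpose_def vec_eq_iff)

lemma ddiag_diff: "ddiag (M - N) = ddiag M - ddiag N"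
  by (simp add: ddiag_def vec_eq_iff)

lemma ddiag_scaleR: "ddiag (c *\<^sub>R M) = c *\<^sub>R ddiag M"
  by (simp add: ddiag_def vec_eq_iff)

lemma ddiag_mult_nth: "(ddiag M ** N) $ i $ j = M $ i $ i * N $ i $ j"
proof -
  have "(ddiag M ** N) $ i $ j = (\<Sum>k\<in>UNIV. if i = k then M $ i $ i * N $ i $ j else 0)"
    unfolding matrix_matrix_mult_def ddiag_def vec_lambda_beta by (rule sum.cong) auto
  then show ?thesis
    by simp
qed

lemma ddiag_mult_ddiag: "ddiag (ddiag M ** N) = ddiag M ** ddiag N"
  by (simp add: vec_eq_iff ddiag_mult_nth ddiag_def[of N] ddiag_def[of "_ ** _"])

lemma matrix_diff_rdistrib:
  fixes A B :: "real^'m^'n" and D :: "real^'k^'m"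
  shows "(A - B) ** D = A ** D - B ** D"
  by (simp add: vec_eq_iff matrix_matrix_mult_def sum_subtractf algebra_simps)

lemma tangent_space_iff: "V \<in> tangent_space Y \<longleftrightarrow> ddiag (V ** transpose Y) = 0"
  unfolding tangent_space_def mem_Collect_eq
  by (subst ddiag_transpose[symmetric]) (simp add: matrix_transpose_mul)

lemma tangent_proj_mem:
  assumes "feasible Y"
  shows "tangent_proj Y Z \<in> tangent_space Y"
  using assms
  by (simp add: tangent_space_iff tangent_proj_def feasible_def matrix_diff_rdistrib
      matrix_mul_assoc[symmetric] ddiag_diff ddiag_mult_ddiag)

lemma tangent_proj_orthogonal:
  assumes "V \<in> tangent_space Y"
  shows "V \<bullet> tangent_proj Y Z = V \<bullet> Z"
  using assms
  by (simp add: tangent_space_iff tangent_proj_def inner_diff_right inner_commute[of V "_ ** _"]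
      inner_mult_right ddiag_inner)

lemma bounded_bilinear_mm:
  "bounded_bilinear ((**) :: real^'m^'n \<Rightarrow> real^'k^'m \<Rightarrow> real^'k^'n)"
  unfolding bilinear_conv_bounded_bilinear[symmetric] bilinear_def
  by (auto intro!: linearI simp: vec_eq_iff matrix_matrix_mult_def sum.distrib algebra_simps
      sum_distrib_left)

lemma bounded_linear_transpose: "bounded_linear (transpose :: real^'m^'n \<Rightarrow> real^'n^'m)"
  unfolding linear_conv_bounded_linear[symmetric]
  by (auto intro!: linearI simp: vec_eq_iff transpose_def)

lemma bounded_linear_ddiag: "bounded_linear (ddiag :: real^'n^'n \<Rightarrow> real^'n^'n)"
  unfolding linear_conv_bounded_linear[symmetric]
  by (auto intro!: linearI simp: vec_eq_iff ddiag_def)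

lemmas mm_has_derivative = bounded_bilinear.FDERIV[OF bounded_bilinear_mm]
lemmas transpose_has_derivative = bounded_linear.has_derivative[OF bounded_linear_transpose]
lemmas ddiag_has_derivative = bounded_linear.has_derivative[OF bounded_linear_ddiag]

lemma gderiv_unique:
  assumes "GDERIV f x :> a" "GDERIV f x :> b"
  shows "a = b"
proof -
  have "(\<lambda>h. h \<bullet> a) = (\<lambda>h. h \<bullet> b)"
    using assms unfolding gderiv_def by (rule has_derivative_unique)
  then have "h \<bullet> a = h \<bullet> b" for h
    by metis
  then show ?thesis
    using vector_eq_ldot by blast
qed

lemma objective_gderiv:
  fixes C :: "real^'n^'n" and Y :: "real^'r^'n"
  assumes "transpose C = C"
  shows "GDERIV (objective C) Y :> 2 *\<^sub>R (C ** Y)"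
proof -
  have "(objective C has_derivative (\<lambda>V. C \<bullet> (Y ** transpose V + V ** transpose Y))) (at Y)"
    unfolding objective_def
    by (intro bounded_linear.has_derivative[OF bounded_linear_inner_right] mm_has_derivative
        transpose_has_derivative has_derivative_ident)
  moreover have "C \<bullet> (Y ** transpose V + V ** transpose Y) = V \<bullet> (2 *\<^sub>R (C ** Y))" for V
  proof -
    have "C \<bullet> (V ** transpose Y) = V \<bullet> (C ** Y)"
      by (metis inner_mult_right inner_commute transpose_transpose)
    moreover have "C \<bullet> (Y ** transpose V) = C \<bullet> (V ** transpose Y)"
      by (metis assms inner_transpose matrix_transpose_mul transpose_transpose)
    ultimately show ?thesis
      by (simp add: inner_add_right)
  qed
  ultimately show ?thesis
    unfolding gderiv_def by simp
qed

lemma objective_euclidean_grad: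
  assumes "transpose C = C"
  shows "euclidean_grad (objective C) Y = 2 *\<^sub>R (C ** Y)"
  unfolding euclidean_grad_def
  using objective_gderiv[OF assms] gderiv_unique by blast

lemma objective_riem_grad:
  fixes C :: "real^'n^'n" and Y :: "real^'r^'n"
  assumes "transpose C = C"
  shows "riem_grad (objective C) Y = 2 *\<^sub>R (C ** Y - ddiag (C ** Y ** transpose Y) ** Y)"
proof -
  have "ddiag ((2 *\<^sub>R (C ** Y)) ** transpose Y) ** Y = 2 *\<^sub>R (ddiag (C ** Y ** transpose Y) ** Y)"
    by (simp only: scalar_matrix_assoc[symmetric] ddiag_scaleR)
  then show ?thesis
    by (simp add: riem_grad_def tangent_proj_def objective_euclidean_grad[OF assms]
        scaleR_diff_right)
qed

lemma objective_riem_hess: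
  fixes C :: "real^'n^'n" and Y V :: "real^'r^'n"
  assumes C: "transpose C = C" and V: "V \<in> tangent_space Y"
  shows "V \<bullet> riem_hess (objective C) Y V = - 2 * (cert_matrix C Y \<bullet> (V ** transpose V))"
proof -
  let ?D = "\<lambda>V. 2 *\<^sub>R (C ** V - (ddiag (C ** Y ** transpose Y) ** V
      + ddiag (C ** Y ** transpose V + C ** V ** transpose Y) ** Y))"
  have C': "((\<lambda>X. C ** X) has_derivative (\<lambda>V. C ** V)) (at Y)"
    using mm_has_derivative[OF has_derivative_const has_derivative_ident, of C Y UNIV]
    by (simp add: bounded_bilinear.zero_left[OF bounded_bilinear_mm])
  have "((\<lambda>X. 2 *\<^sub>R (C ** X - ddiag (C ** X ** transpose X) ** X)) has_derivative ?D) (at Y)"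
    by (intro has_derivative_scaleR_right has_derivative_diff mm_has_derivative
        ddiag_has_derivative transpose_has_derivative has_derivative_ident C')
  then have "(riem_grad (objective C) has_derivative ?D) (at Y)"
    unfolding ext[of "riem_grad (objective C)", OF objective_riem_grad[OF C]] .
  then have fd: "frechet_derivative (riem_grad (objective C)) (at Y) V = ?D V"
    by (rule fun_cong[OF frechet_derivative_at[symmetric]])
  have z: "V \<bullet> (ddiag M ** Y) = 0" for M
    using V by (simp add: tangent_space_iff inner_commute[of V] inner_mult_right ddiag_inner)
  have s: "V \<bullet> (M ** V) = M \<bullet> (V ** transpose V)" for M :: "real^'n^'n"
    by (simp add: inner_commute[of V] inner_mult_right)
  show ?thesis
    unfolding riem_hess_def tangent_proj_orthogonal[OF V] fd cert_matrix_def
    by (simp add: inner_diff_right inner_diff_left inner_add_right z s)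
qed

text \<open>
  For a symmetric cost matrix, second-order criticality amounts to the usual explicit
  conditions in terms of the matrix \<open>S(Y) = ddiag(C Y Y\<^sup>T) - C\<close>.
\<close>

theorem second_order_critical_iff:
  fixes C :: "real^'n^'n" and Y :: "real^'r^'n"
  assumes "transpose C = C"
  shows "second_order_critical C Y \<longleftrightarrow>
     feasible Y \<and>
     cert_matrix C Y ** Y = 0 \<and>
     (\<forall>V. ddiag (Y ** transpose V) = 0 \<longrightarrow> cert_matrix C Y \<bullet> (V ** transpose V) \<ge> 0)"
proof -
  have "riem_grad (objective C) Y = 0 \<longleftrightarrow> cert_matrix C Y ** Y = 0"
    by (auto simp: objective_riem_grad[OF assms] cert_matrix_def matrix_diff_rdistrib)
  moreover have "V \<bullet> riem_hess (objective C) Y V \<le> 0 \<longleftrightarrow> cert_matrix C Y \<bullet> (V ** transpose V) \<ge> 0"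
    if "V \<in> tangent_space Y" for V
    by (simp add: objective_riem_hess[OF assms that])
  ultimately show ?thesis
    unfolding second_order_critical_def by (auto simp: tangent_space_def)
qed

end

theory Submission
  imports Defs
begin

text \<open>
  Absorb the labels into the rows: put \<open>y\<^sub>i = z\<^sub>i Y\<^sub>i\<close>, a unit vector, and \<open>x\<^sub>i\<^sub>j = y\<^sub>i \<bullet> y\<^sub>j\<close>.
  The claim is that all \<open>y\<^sub>i\<close> coincide.

  The second-order condition is tested in the directions in which every \<open>y\<^sub>i\<close> moves towards the
  same fixed vector \<open>e\<close>, that is along the projection of \<open>e\<close> to the tangent space of the sphere
  at \<open>y\<^sub>i\<close>.  Averaged over an orthonormal basis of vectors \<open>e\<close>, the outcome depends on \<open>Y\<close>
  only through the numbers \<open>x\<^sub>i\<^sub>j\<close>: with \<open>h\<^sub>i\<^sub>j = 1 - x\<^sub>i\<^sub>j\<close>, it says that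
  \<open>\<Sum> z\<^sub>i z\<^sub>j C\<^sub>i\<^sub>j h\<^sub>i\<^sub>j (r - 3 + h\<^sub>i\<^sub>j) \<le> 0\<close> (\<open>second_order_gram_inequality\<close>).

  Off the diagonal, \<open>C\<close> is a signal \<open>\<kappa> z z\<^sup>T\<close> plus a noise matrix \<open>M\<close>.  Let \<open>w\<^sub>i\<close> be the deviation
  of \<open>y\<^sub>i\<close> from the mean, \<open>a\<^sub>i = \<bar>w\<^sub>i\<bar>\<^sup>2 \<le> 4\<close> and \<open>g\<^sub>i\<^sub>j = w\<^sub>i \<bullet> w\<^sub>j\<close>, so that
  \<open>h\<^sub>i\<^sub>j = (a\<^sub>i + a\<^sub>j)/2 - g\<^sub>i\<^sub>j\<close>.  The terms of \<open>h\<close> and \<open>h\<^sup>2\<close> that depend on one index see only the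
  row sums of the signed matrix, which are at least \<open>D\<close>.  Among the others, the signal contributes
  with the good sign or, because \<open>\<Sum> w\<^sub>i = 0\<close>, not at all.  What is left of the noise is bounded
  by \<open>\<parallel>M\<parallel>\<close> times \<open>(r - 3) + 14\<close> times \<open>\<Sum> a\<^sub>i\<close>; the constant is \<open>14 = 2 + 4 + 8\<close>, from
  \<open>a\<^sub>i a\<^sub>j / 2\<close>, \<open>g\<^sub>i\<^sub>j\<^sup>2\<close> and \<open>2 a\<^sub>i g\<^sub>i\<^sub>j\<close>.  Hence
  \<open>(r - 3) D \<Sum> a\<^sub>i \<le> (r + 11) \<parallel>M\<parallel> \<Sum> a\<^sub>i\<close>, and all \<open>a\<^sub>i\<close> vanish once
  \<open>(r - 3) D > (r + 11) \<parallel>M\<parallel>\<close> (\<open>gram_inequality_rigidity\<close>, \<open>synchronization_benign\<close>).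

  Under the block model the row sums are \<open>d\<^sub>i\<^sup>z + p\<close>, because \<open>z\<close> is orthogonal to the all-ones
  vector.  If the exact mean density is subtracted, \<open>M = A - E A\<close>; if the
  empirical density is subtracted, \<open>M\<close> has in addition a multiple of the all-ones matrix, whose
  norm is at most \<open>\<parallel>A - E A\<parallel> + p\<close>.
\<close>

section \<open>Operator norm bounds\<close>

lemma op_norm_mult_le: "norm (M *v v) \<le> op_norm M * norm v"
  unfolding op_norm_def
  by (rule onorm) (rule matrix_vector_mul_bounded_linear)

lemma op_norm_nonneg: "0 \<le> op_norm M"
  unfolding op_norm_def
  by (rule onorm_pos_le) (rule matrix_vector_mul_bounded_linear)

lemma op_norm_triangle: "op_norm (M + N) \<le> op_norm M + op_norm N"
  unfolding op_norm_def matrix_vector_mult_add_rdistrib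
  by (rule onorm_triangle) (rule matrix_vector_mul_bounded_linear)+

lemma op_norm_outer_one_le:
  "op_norm (s *\<^sub>R outer 1 1 :: real^'n^'n) \<le> \<bar>s\<bar> * real CARD('n)"
  unfolding op_norm_def
proof (rule onorm_le)
  fix v :: "real^'n"
  have n1: "norm (1 :: real^'n) = sqrt (real CARD('n))"
    by (simp add: norm_eq_sqrt_inner inner_vec_def)
  have "(s *\<^sub>R outer 1 1 :: real^'n^'n) *v v = (s * (1 \<bullet> v)) *\<^sub>R 1"
    by (simp add: vec_eq_iff matrix_vector_mult_def outer_def inner_vec_def sum_distrib_left)
  then have "norm ((s *\<^sub>R outer 1 1 :: real^'n^'n) *v v) = \<bar>s\<bar> * \<bar>1 \<bullet> v\<bar> * norm (1 :: real^'n)"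
    by (simp add: abs_mult)
  also have "\<dots> \<le> \<bar>s\<bar> * (norm (1 :: real^'n) * norm v) * norm (1 :: real^'n)"
    by (intro mult_right_mono mult_left_mono Cauchy_Schwarz_ineq2) auto
  also have "\<dots> = \<bar>s\<bar> * real CARD('n) * norm v"
    by (simp add: n1)
  finally show "norm ((s *\<^sub>R outer 1 1 :: real^'n^'n) *v v) \<le> \<bar>s\<bar> * real CARD('n) * norm v" .
qed

text \<open>
  The trace duality between \<open>M\<close> and the cross Gram matrix of \<open>u\<close> and \<open>v\<close>: coordinate by coordinate
  this is the bound for the bilinear form of \<open>M\<close>.  Allowing any Euclidean space for the vectors
  makes it applicable to scalars and to tensor squares, which is how products and squares
  of Gram matrix entries are estimated below.
\<close>

lemma gram_form_bound:
  fixes M :: "real^'n^'n" and u v :: "'n \<Rightarrow> 'b::euclidean_space"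
  shows "\<bar>\<Sum>i\<in>UNIV. \<Sum>j\<in>UNIV. M $ i $ j * (u i \<bullet> v j)\<bar>
    \<le> op_norm M * ((\<Sum>i\<in>UNIV. (norm (u i))\<^sup>2) + (\<Sum>i\<in>UNIV. (norm (v i))\<^sup>2)) / 2"
proof -
  define x where "x b = (\<chi> i. u i \<bullet> b)" for b
  define y where "y b = (\<chi> i. v i \<bullet> b)" for b
  have sq: "(\<Sum>b\<in>Basis. (norm (\<chi> i. f i \<bullet> b))\<^sup>2) = (\<Sum>i\<in>UNIV. (norm (f i))\<^sup>2)"
    for f :: "'n \<Rightarrow> 'b"
  proof -
    have "(\<Sum>b\<in>Basis. (norm (\<chi> i. f i \<bullet> b))\<^sup>2) = (\<Sum>b\<in>Basis. \<Sum>i\<in>UNIV. (f i \<bullet> b)\<^sup>2)"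
      unfolding power2_norm_eq_inner inner_vec_def by (simp add: power2_eq_square)
    also have "\<dots> = (\<Sum>i\<in>UNIV. \<Sum>b\<in>Basis. (f i \<bullet> b)\<^sup>2)"
      by (rule sum.swap)
    also have "\<dots> = (\<Sum>i\<in>UNIV. (norm (f i))\<^sup>2)"
      unfolding power2_norm_eq_inner by (simp add: power2_eq_square euclidean_inner[symmetric])
    finally show ?thesis .
  qed
  have "(\<Sum>i\<in>UNIV. \<Sum>j\<in>UNIV. M $ i $ j * (u i \<bullet> v j))
      = (\<Sum>i\<in>UNIV. \<Sum>j\<in>UNIV. \<Sum>b\<in>Basis. M $ i $ j * ((u i \<bullet> b) * (v j \<bullet> b)))"
    by (subst euclidean_inner) (simp add: sum_distrib_left)
  also have "\<dots> = (\<Sum>i\<in>UNIV. \<Sum>b\<in>Basis. \<Sum>j\<in>UNIV. M $ i $ j * ((u i \<bullet> b) * (v j \<bullet> b)))"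
    by (intro sum.cong refl) (rule sum.swap)
  also have "\<dots> = (\<Sum>b\<in>Basis. \<Sum>i\<in>UNIV. \<Sum>j\<in>UNIV. M $ i $ j * ((u i \<bullet> b) * (v j \<bullet> b)))"
    by (rule sum.swap)
  also have "\<dots> = (\<Sum>b\<in>Basis. x b \<bullet> (M *v y b))"
    by (simp add: x_def y_def inner_vec_def matrix_vector_mult_def sum_distrib_left mult_ac)
  finally have eq: "(\<Sum>i\<in>UNIV. \<Sum>j\<in>UNIV. M $ i $ j * (u i \<bullet> v j)) = (\<Sum>b\<in>Basis. x b \<bullet> (M *v y b))" .
  have le: "\<bar>x b \<bullet> (M *v y b)\<bar> \<le> op_norm M * (((norm (x b))\<^sup>2 + (norm (y b))\<^sup>2) / 2)" for b
  proof -
    have "\<bar>x b \<bullet> (M *v y b)\<bar> \<le> norm (x b) * norm (M *v y b)"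
      by (rule Cauchy_Schwarz_ineq2)
    also have "\<dots> \<le> norm (x b) * (op_norm M * norm (y b))"
      by (intro mult_left_mono op_norm_mult_le) simp
    also have "\<dots> = op_norm M * (norm (x b) * norm (y b))"
      by simp
    also have "\<dots> \<le> op_norm M * (((norm (x b))\<^sup>2 + (norm (y b))\<^sup>2) / 2)"
      using sum_squares_bound[of "norm (x b)" "norm (y b)"]
      by (intro mult_left_mono op_norm_nonneg) simp
    finally show ?thesis .
  qed
  have "\<bar>\<Sum>b\<in>Basis. x b \<bullet> (M *v y b)\<bar>
      \<le> (\<Sum>b\<in>Basis. op_norm M * (((norm (x b))\<^sup>2 + (norm (y b))\<^sup>2) / 2))"
    by (rule order_trans[OF sum_abs sum_mono[OF le]])
  also have "\<dots> = op_norm M * (((\<Sum>b\<in>Basis. (norm (x b))\<^sup>2) + (\<Sum>b\<in>Basis. (norm (y b))\<^sup>2)) / 2)"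
    by (simp only: sum_distrib_left[symmetric] sum_divide_distrib[symmetric] sum.distrib)
  finally show ?thesis
    unfolding eq x_def y_def sq by simp
qed

text \<open>Conjugation by a diagonal sign matrix is orthogonal; the signs move into the vectors.\<close>

lemma signed_gram_form_bound:
  fixes M :: "real^'n^'n" and u v :: "'n \<Rightarrow> 'b::euclidean_space"
  assumes z: "\<And>i. z $ i = 1 \<or> z $ i = (-1::real)"
  shows "\<bar>\<Sum>i\<in>UNIV. \<Sum>j\<in>UNIV. z $ i * z $ j * M $ i $ j * (u i \<bullet> v j)\<bar>
    \<le> op_norm M * ((\<Sum>i\<in>UNIV. (norm (u i))\<^sup>2) + (\<Sum>i\<in>UNIV. (norm (v i))\<^sup>2)) / 2"
proof -
  have a: "\<bar>z $ i\<bar> = 1" for i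
    using z[of i] by auto
  show ?thesis
    using gram_form_bound[of M "\<lambda>i. z $ i *\<^sub>R u i" "\<lambda>i. z $ i *\<^sub>R v i"]
    by (simp add: a mult_ac)
qed

section \<open>The second-order condition in terms of the Gram matrix\<close>

text \<open>
  With \<open>P\<^sub>i\<close> the orthogonal projection along \<open>y\<^sub>i\<close>, the test directions are \<open>z\<^sub>i P\<^sub>i e\<^sub>k\<close>, and
  summing over \<open>k\<close> yields \<open>tr (P\<^sub>i P\<^sub>j) = r - 2 + x\<^sub>i\<^sub>j\<^sup>2\<close>.  The diagonal part of the
  certificate matrix is paired with \<open>tr P\<^sub>i = r - 1\<close>, so the condition collects to the sign of
  \<open>(r - 1) x\<^sub>i\<^sub>j - (r - 2) - x\<^sub>i\<^sub>j\<^sup>2 = - (1 - x\<^sub>i\<^sub>j) (r - 2 - x\<^sub>i\<^sub>j)\<close> weighted by the signed entries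
  of \<open>C\<close>.
\<close>

lemma second_order_gram_inequality:
  fixes C :: "real^'n^'n" and Y :: "real^'r^'n" and z :: "real^'n"
  assumes C: "transpose C = C" and crit: "second_order_critical C Y"
    and z: "\<And>i. z $ i = 1 \<or> z $ i = -1"
    and y: "\<And>i. y i = z $ i *\<^sub>R Y $ i"
  shows "norm (y i) = 1"
    and "(\<Sum>i\<in>UNIV. \<Sum>j\<in>UNIV. z $ i * z $ j * C $ i $ j *
           ((1 - y i \<bullet> y j) * (real CARD('r) - 2 - y i \<bullet> y j))) \<le> 0"
proof -
  have zz: "z $ i * z $ i = 1" for i
    using z[of i] by auto
  have gram: "(V ** transpose W) $ i $ j = V $ i \<bullet> W $ j" for V W :: "real^'r^'n" and i j
    by (simp add: matrix_matrix_mult_def transpose_def inner_vec_def)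
  have feas: "feasible Y"
    and soc: "\<And>V. ddiag (Y ** transpose V) = 0 \<Longrightarrow> cert_matrix C Y \<bullet> (V ** transpose V) \<ge> 0"
    using crit unfolding second_order_critical_iff[OF C] by auto
  have YY: "Y $ i \<bullet> Y $ i = 1" for i
  proof -
    have "ddiag (Y ** transpose Y) $ i $ i = (mat 1 :: real^'n^'n) $ i $ i"
      using feas unfolding feasible_def by simp
    then show ?thesis
      by (simp add: ddiag_def gram mat_def)
  qed
  have yy: "y i \<bullet> y i = 1" for i
    unfolding y by (simp add: YY) (simp add: zz)
  show "norm (y i) = 1"
    using yy by (simp add: norm_eq_1)
  define V :: "'r \<Rightarrow> real^'r^'n"
    where "V k = (\<chi> i. z $ i *\<^sub>R (axis k 1 - (y i $ k) *\<^sub>R y i))" for k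
  define T where "T i j = z $ i * z $ j * cert_matrix C Y $ i $ j" for i j
  have tang: "ddiag (Y ** transpose (V k)) = 0" for k
  proof -
    have "Y $ i \<bullet> V k $ i = y i \<bullet> (axis k 1 - (y i $ k) *\<^sub>R y i)" for i
      by (simp add: V_def y)
    also have "\<dots> i = 0" for i
      by (simp add: inner_diff_right inner_axis yy)
    finally show ?thesis
      by (simp add: ddiag_def vec_eq_iff gram)
  qed
  have VV: "V k $ i \<bullet> V k $ j = z $ i * z $ j *
      (1 - (y i $ k)\<^sup>2 - (y j $ k)\<^sup>2 + y i $ k * y j $ k * (y i \<bullet> y j))" for k i j
    by (simp add: V_def inner_diff_left inner_diff_right inner_axis inner_axis' inner_axis_axis
        power2_eq_square algebra_simps inner_commute)
  have sumk: "(\<Sum>k\<in>UNIV. V k $ i \<bullet> V k $ j) = z $ i * z $ j * (real CARD('r) - 2 + (y i \<bullet> y j)\<^sup>2)" for i j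
  proof -
    have 1: "(\<Sum>k\<in>UNIV. (y i $ k)\<^sup>2) = 1" for i
      using yy[of i] by (simp add: inner_vec_def power2_eq_square)
    have 2: "(\<Sum>k\<in>UNIV. y i $ k * y j $ k * (y i \<bullet> y j)) = (y i \<bullet> y j)\<^sup>2"
      unfolding sum_distrib_right[symmetric] by (simp add: inner_vec_def power2_eq_square)
    show ?thesis
      unfolding VV sum_distrib_left[symmetric] sum.distrib sum_subtractf 1 2 by simp
  qed
  have "0 \<le> (\<Sum>k\<in>UNIV. cert_matrix C Y \<bullet> (V k ** transpose (V k)))"
    by (intro sum_nonneg soc tang)
  also have "\<dots> = (\<Sum>k\<in>UNIV. \<Sum>i\<in>UNIV. \<Sum>j\<in>UNIV. cert_matrix C Y $ i $ j * (V k $ i \<bullet> V k $ j))"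
    by (subst inner_vec_def, subst inner_vec_def) (simp add: gram)
  also have "\<dots> = (\<Sum>i\<in>UNIV. \<Sum>k\<in>UNIV. \<Sum>j\<in>UNIV. cert_matrix C Y $ i $ j * (V k $ i \<bullet> V k $ j))"
    by (rule sum.swap)
  also have "\<dots> = (\<Sum>i\<in>UNIV. \<Sum>j\<in>UNIV. \<Sum>k\<in>UNIV. cert_matrix C Y $ i $ j * (V k $ i \<bullet> V k $ j))"
    by (intro sum.cong refl) (rule sum.swap)
  also have "\<dots> = (\<Sum>i\<in>UNIV. \<Sum>j\<in>UNIV. T i j * (real CARD('r) - 2 + (y i \<bullet> y j)\<^sup>2))"
    unfolding sum_distrib_left[symmetric] sumk T_def by (simp add: mult_ac)
  also have "\<dots> = (\<Sum>i\<in>UNIV. (\<Sum>j\<in>UNIV. z $ i * z $ j * C $ i $ j * (y i \<bullet> y j)) * (real CARD('r) - 1)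
      - (\<Sum>j\<in>UNIV. z $ i * z $ j * C $ i $ j * (real CARD('r) - 2 + (y i \<bullet> y j)\<^sup>2)))"
  proof (rule sum.cong[OF refl])
    fix i
    have T: "T i j = (if i = j then (\<Sum>k\<in>UNIV. z $ i * z $ k * C $ i $ k * (y i \<bullet> y k)) else 0)
        - z $ i * z $ j * C $ i $ j" for j
    proof -
      have "z $ i * z $ k * C $ i $ k * (y i \<bullet> y k) = C $ i $ k * (Y $ k \<bullet> Y $ i)" for k
        using z[of i] z[of k] by (auto simp: y inner_commute)
      moreover have "(C ** Y ** transpose Y) $ i $ i = (\<Sum>k\<in>UNIV. C $ i $ k * (Y $ k \<bullet> Y $ i))"
        unfolding matrix_mul_assoc[symmetric]
        by (simp add: matrix_matrix_mult_def[of C] gram)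
      ultimately have "(C ** Y ** transpose Y) $ i $ i
          = (\<Sum>k\<in>UNIV. z $ i * z $ k * C $ i $ k * (y i \<bullet> y k))"
        by (simp only:)
      then show ?thesis
        by (cases "i = j") (auto simp: T_def cert_matrix_def ddiag_def right_diff_distrib zz)
    qed
    show "(\<Sum>j\<in>UNIV. T i j * (real CARD('r) - 2 + (y i \<bullet> y j)\<^sup>2)) =
      (\<Sum>j\<in>UNIV. z $ i * z $ j * C $ i $ j * (y i \<bullet> y j)) * (real CARD('r) - 1)
      - (\<Sum>j\<in>UNIV. z $ i * z $ j * C $ i $ j * (real CARD('r) - 2 + (y i \<bullet> y j)\<^sup>2))"
      unfolding T left_diff_distrib sum_subtractf
      by (simp add: if_distrib[of "\<lambda>t. t * _"] yy cong: if_cong)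
  qed
  also have "\<dots> = - (\<Sum>i\<in>UNIV. \<Sum>j\<in>UNIV. z $ i * z $ j * C $ i $ j *
           ((1 - y i \<bullet> y j) * (real CARD('r) - 2 - y i \<bullet> y j)))"
    unfolding sum_negf[symmetric] sum_distrib_right sum_subtractf[symmetric]
    by (intro sum.cong refl) (simp add: algebra_simps power2_eq_square)
  finally show "(\<Sum>i\<in>UNIV. \<Sum>j\<in>UNIV. z $ i * z $ j * C $ i $ j *
           ((1 - y i \<bullet> y j) * (real CARD('r) - 2 - y i \<bullet> y j))) \<le> 0"
    by simp
qed

section \<open>Rigidity of configurations of unit vectors\<close>

text \<open>
  The weights \<open>\<kappa> + z\<^sub>i z\<^sub>j M\<^sub>i\<^sub>j\<close> are symmetric with row sums at least \<open>D\<close>, but may be negative.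
  The inequality is expanded around the mean of the vectors.  The noise must be compared with
  \<open>\<Sum> \<bar>y\<^sub>i - m\<bar>\<^sup>2\<close>, which the row sums control from below; bounding the trace norm of
  \<open>((1 - x\<^sub>i\<^sub>j)\<^sup>2)\<close> directly would lose this, since the one-index terms of its expansion are too large,
  while the row sums give exactly these terms the good sign.
\<close>

lemma gram_inequality_rigidity:
  fixes M :: "real^'n^'n" and y :: "'n \<Rightarrow> real^'r" and z :: "real^'n" and \<kappa> c D :: real
  assumes z: "\<And>i. z $ i = 1 \<or> z $ i = -1"
    and M: "transpose M = M"
    and \<kappa>: "0 \<le> \<kappa>" and c: "0 < c"
    and y1: "\<And>i. norm (y i) = 1"
    and D: "\<And>i. D \<le> (\<Sum>j\<in>UNIV. \<kappa> + z $ i * z $ j * M $ i $ j)"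
    and gap: "(c + 14) * op_norm M < c * D"
    and ineq: "(\<Sum>i\<in>UNIV. \<Sum>j\<in>UNIV. (\<kappa> + z $ i * z $ j * M $ i $ j) *
           ((1 - y i \<bullet> y j) * (c + (1 - y i \<bullet> y j)))) \<le> 0"
  shows "\<exists>m. \<forall>i. y i = m"
proof -
  define m where "m = (1 / real CARD('n)) *\<^sub>R (\<Sum>i\<in>UNIV. y i)"
  define w where "w i = y i - m" for i
  define a where "a i = (norm (w i))\<^sup>2" for i
  define g where "g i j = w i \<bullet> w j" for i j
  define E where "E i j = z $ i * z $ j * M $ i $ j" for i j
  define B where "B i j = \<kappa> + E i j" for i j
  define \<rho> where "\<rho> i = (\<Sum>j\<in>UNIV. B i j)" for i
  define \<epsilon> where "\<epsilon> = op_norm M"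
  define s where "s = (\<Sum>i\<in>UNIV. a i)"
  have \<epsilon>0: "0 \<le> \<epsilon>"
    unfolding \<epsilon>_def by (rule op_norm_nonneg)
  have Dpos: "0 \<le> D"
  proof -
    have "0 \<le> (c + 14) * op_norm M"
      using c \<epsilon>0 by (simp add: \<epsilon>_def)
    then have "0 < c * D" using gap by linarith
    then show ?thesis using c by (simp add: zero_less_mult_iff)
  qed
  have \<rho>: "D \<le> \<rho> i" for i
    using D[of i] by (simp add: \<rho>_def B_def E_def)
  have sw: "(\<Sum>i\<in>UNIV. w i) = 0"
    by (simp add: w_def sum_subtractf m_def sum_constant_scaleR del: sum_constant)
  have m1: "norm m \<le> 1"
  proof -
    have "norm (\<Sum>i\<in>UNIV. y i) \<le> (\<Sum>i\<in>(UNIV::'n set). 1)"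
      by (rule sum_norm_le) (simp add: y1)
    then show ?thesis
      by (simp add: m_def)
  qed
  have a0: "0 \<le> a i" for i
    by (simp add: a_def)
  have a4: "a i \<le> 4" for i
  proof -
    have "norm (w i) \<le> 2"
      using norm_triangle_ineq4[of "y i" m] m1 y1[of i] by (simp add: w_def)
    then have "(norm (w i))\<^sup>2 \<le> 2\<^sup>2"
      by (rule power_mono) simp
    then show ?thesis by (simp add: a_def)
  qed
  have h: "1 - y i \<bullet> y j = (a i + a j) / 2 - g i j" for i j
  proof -
    have yy: "y i \<bullet> y i = 1" for i
      using y1 by (simp add: norm_eq_1)
    have "(norm (w i - w j))\<^sup>2 = a i + a j - 2 * g i j"
      by (simp add: a_def g_def power2_norm_eq_inner inner_diff_left inner_diff_right inner_commute)
    moreover have "(norm (w i - w j))\<^sup>2 = 2 - 2 * (y i \<bullet> y j)"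
      by (simp add: w_def power2_norm_eq_inner inner_diff_left inner_diff_right inner_commute yy)
    ultimately show ?thesis by (simp add: field_simps)
  qed
  have gs: "g i j = g j i" for i j
    by (simp add: g_def inner_commute)
  have Es: "E i j = E j i" for i j
  proof -
    have "M $ i $ j = M $ j $ i"
      by (metis M transpose_def vec_lambda_beta)
    then show ?thesis by (simp add: E_def mult_ac)
  qed
  have Bs: "B i j = B j i" for i j
    by (simp add: B_def Es)
  have row: "(\<Sum>i\<in>UNIV. \<Sum>j\<in>UNIV. B i j * f i) = (\<Sum>i\<in>UNIV. \<rho> i * f i)" for f
    by (simp add: \<rho>_def sum_distrib_right)
  have col: "(\<Sum>i\<in>UNIV. \<Sum>j\<in>UNIV. B i j * f j) = (\<Sum>i\<in>UNIV. \<rho> i * f i)" for f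
    by (subst sum.swap, subst Bs) (rule row)
  have flat: "(\<Sum>j\<in>UNIV. g i j) = 0" for i
    by (simp add: g_def inner_sum_right[symmetric] sw)
  \<comment> \<open>The signal drops out of every sum in which \<open>g\<close> occurs linearly, as its rows sum to 0.\<close>
  have Bg: "(\<Sum>i\<in>UNIV. \<Sum>j\<in>UNIV. B i j * g i j) = (\<Sum>i\<in>UNIV. \<Sum>j\<in>UNIV. E i j * g i j)"
    by (simp add: B_def distrib_right sum.distrib sum_distrib_left[symmetric] flat)
  have Bag: "(\<Sum>i\<in>UNIV. \<Sum>j\<in>UNIV. B i j * (a i * g i j)) = (\<Sum>i\<in>UNIV. \<Sum>j\<in>UNIV. E i j * (a i * g i j))"
    by (simp add: B_def distrib_right sum.distrib sum_distrib_left[symmetric] flat)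
  have Bga: "(\<Sum>i\<in>UNIV. \<Sum>j\<in>UNIV. B i j * (a j * g i j)) = (\<Sum>i\<in>UNIV. \<Sum>j\<in>UNIV. E i j * (a i * g i j))"
    unfolding Bag[symmetric] by (subst sum.swap, subst Bs, subst gs) (rule refl)
  have Baa: "(\<Sum>i\<in>UNIV. \<Sum>j\<in>UNIV. B i j * (a i * a j)) \<ge> (\<Sum>i\<in>UNIV. \<Sum>j\<in>UNIV. E i j * (a i * a j))"
    by (intro sum_mono) (simp add: B_def distrib_right a0 \<kappa>)
  have Bgg: "(\<Sum>i\<in>UNIV. \<Sum>j\<in>UNIV. B i j * (g i j)\<^sup>2) \<ge> (\<Sum>i\<in>UNIV. \<Sum>j\<in>UNIV. E i j * (g i j)\<^sup>2)"
    by (intro sum_mono) (simp add: B_def distrib_right \<kappa>)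
  have "(\<Sum>i\<in>UNIV. \<Sum>j\<in>UNIV. B i j * ((1 - y i \<bullet> y j) * (c + (1 - y i \<bullet> y j))))
     = (\<Sum>i\<in>UNIV. \<Sum>j\<in>UNIV. c / 2 * (B i j * a i) + c / 2 * (B i j * a j) - c * (B i j * g i j)
       + 1 / 4 * (B i j * (a i)\<^sup>2) + 1 / 4 * (B i j * (a j)\<^sup>2) + 1 / 2 * (B i j * (a i * a j))
       + B i j * (g i j)\<^sup>2 - B i j * (a i * g i j) - B i j * (a j * g i j))"
    unfolding h by (intro sum.cong refl) (simp add: field_simps power2_eq_square)
  also have "\<dots> = c * (\<Sum>i\<in>UNIV. \<rho> i * a i) - c * (\<Sum>i\<in>UNIV. \<Sum>j\<in>UNIV. E i j * g i j)
      + 1 / 2 * (\<Sum>i\<in>UNIV. \<rho> i * (a i)\<^sup>2)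
      + 1 / 2 * (\<Sum>i\<in>UNIV. \<Sum>j\<in>UNIV. B i j * (a i * a j))
      + (\<Sum>i\<in>UNIV. \<Sum>j\<in>UNIV. B i j * (g i j)\<^sup>2)
      - 2 * (\<Sum>i\<in>UNIV. \<Sum>j\<in>UNIV. E i j * (a i * g i j))"
    unfolding sum.distrib sum_subtractf sum_distrib_left[symmetric] row col Bg Bag Bga by simp
  finally have main: "c * (\<Sum>i\<in>UNIV. \<rho> i * a i) + 1 / 2 * (\<Sum>i\<in>UNIV. \<rho> i * (a i)\<^sup>2)
      \<le> c * (\<Sum>i\<in>UNIV. \<Sum>j\<in>UNIV. E i j * g i j)
       - 1 / 2 * (\<Sum>i\<in>UNIV. \<Sum>j\<in>UNIV. E i j * (a i * a j))
       - (\<Sum>i\<in>UNIV. \<Sum>j\<in>UNIV. E i j * (g i j)\<^sup>2)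
       + 2 * (\<Sum>i\<in>UNIV. \<Sum>j\<in>UNIV. E i j * (a i * g i j))"
    using ineq Baa Bgg unfolding B_def[symmetric] E_def[symmetric] by linarith
  have sq: "(\<Sum>i\<in>UNIV. (a i)\<^sup>2) \<le> 4 * s"
    unfolding s_def sum_distrib_left power2_eq_square by (intro sum_mono mult_right_mono a4 a0)
  have cube: "(\<Sum>i\<in>UNIV. (a i)\<^sup>2 * a i) \<le> 16 * s"
    unfolding s_def sum_distrib_left
  proof (intro sum_mono mult_right_mono a0)
    show "(a i)\<^sup>2 \<le> 16" for i
      using power_mono[OF a4[of i] a0[of i], of 2] by simp
  qed
  have Eg: "(\<Sum>i\<in>UNIV. \<Sum>j\<in>UNIV. E i j * g i j) \<le> \<epsilon> * s"
    using signed_gram_form_bound[of z M w w, OF z]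
    by (simp add: E_def g_def a_def s_def \<epsilon>_def)
  have Eaa: "- (\<Sum>i\<in>UNIV. \<Sum>j\<in>UNIV. E i j * (a i * a j)) \<le> \<epsilon> * (4 * s)"
  proof -
    have "- (\<Sum>i\<in>UNIV. \<Sum>j\<in>UNIV. E i j * (a i * a j)) \<le> \<epsilon> * (\<Sum>i\<in>UNIV. (a i)\<^sup>2)"
      using signed_gram_form_bound[of z M a a, OF z]
      by (simp add: E_def \<epsilon>_def)
    also have "\<dots> \<le> \<epsilon> * (4 * s)"
      by (intro mult_left_mono sq \<epsilon>0)
    finally show ?thesis .
  qed
  have Egg: "- (\<Sum>i\<in>UNIV. \<Sum>j\<in>UNIV. E i j * (g i j)\<^sup>2) \<le> \<epsilon> * (4 * s)"
  proof -
    \<comment> \<open>The squared Gram matrix is the Gram matrix of the tensor squares \<open>w\<^sub>i w\<^sub>i\<^sup>T\<close>.\<close>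
    have tensor: "outer u u \<bullet> outer v v = (u \<bullet> v)\<^sup>2" for u v :: "real^'r"
      by (simp add: outer_def inner_vec_def power2_eq_square sum_product mult_ac)
    have "(norm (outer (w i) (w i)))\<^sup>2 = (a i)\<^sup>2" for i
      by (simp add: power2_norm_eq_inner tensor a_def)
    then have "- (\<Sum>i\<in>UNIV. \<Sum>j\<in>UNIV. E i j * (g i j)\<^sup>2) \<le> \<epsilon> * (\<Sum>i\<in>UNIV. (a i)\<^sup>2)"
      using signed_gram_form_bound[of z M "\<lambda>i. outer (w i) (w i)" "\<lambda>i. outer (w i) (w i)", OF z]
      by (simp add: E_def \<epsilon>_def tensor g_def)
    also have "\<dots> \<le> \<epsilon> * (4 * s)"
      by (intro mult_left_mono sq \<epsilon>0)
    finally show ?thesis .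
  qed
  have Eag: "(\<Sum>i\<in>UNIV. \<Sum>j\<in>UNIV. E i j * (a i * g i j)) \<le> \<epsilon> * (4 * s)"
  proof -
    \<comment> \<open>The factor 2 is moved across to balance \<open>\<Sum> a\<^sub>i\<^sup>3 \<le> 16 \<Sum> a\<^sub>i\<close> against \<open>\<Sum> a\<^sub>i\<close>: both vector families
      then have square sum at most \<open>4 \<Sum> a\<^sub>i\<close>.\<close>
    have 1: "(norm ((a i / 2) *\<^sub>R w i))\<^sup>2 = (a i)\<^sup>2 * a i / 4" for i
      by (simp add: power_mult_distrib power_divide a_def)
    have 2: "(norm (2 *\<^sub>R w i))\<^sup>2 = 4 * a i" for i
      by (simp add: power_mult_distrib a_def)
    have 3: "((a i / 2) *\<^sub>R w i) \<bullet> (2 *\<^sub>R w j) = a i * g i j" for i j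
      by (simp add: g_def)
    have "(\<Sum>i\<in>UNIV. \<Sum>j\<in>UNIV. E i j * (a i * g i j))
        \<le> \<epsilon> * ((\<Sum>i\<in>UNIV. (a i)\<^sup>2 * a i / 4) + (\<Sum>i\<in>UNIV. 4 * a i)) / 2"
      using signed_gram_form_bound[of z M "\<lambda>i. (a i / 2) *\<^sub>R w i" "\<lambda>i. 2 *\<^sub>R w i", OF z]
      unfolding 1 2 3 by (simp add: E_def \<epsilon>_def)
    also have "\<dots> = \<epsilon> * (((\<Sum>i\<in>UNIV. (a i)\<^sup>2 * a i) / 4 + 4 * s) / 2)"
      by (simp add: s_def sum_distrib_left sum_divide_distrib)
    also have "\<dots> \<le> \<epsilon> * (4 * s)"
      using cube by (intro mult_left_mono \<epsilon>0) simp
    finally show ?thesis .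
  qed
  have low1: "D * s \<le> (\<Sum>i\<in>UNIV. \<rho> i * a i)"
    unfolding s_def sum_distrib_left by (intro sum_mono mult_right_mono \<rho> a0)
  have low2: "0 \<le> (\<Sum>i\<in>UNIV. \<rho> i * (a i)\<^sup>2)"
    by (intro sum_nonneg mult_nonneg_nonneg order_trans[OF Dpos \<rho>]) simp
  have "c * (D * s) \<le> c * (\<epsilon> * s) + 14 * (\<epsilon> * s)"
    using main Eaa Egg Eag low2 mult_left_mono[OF low1, of c] mult_left_mono[OF Eg, of c] c by linarith
  then have "(c * D - (c + 14) * \<epsilon>) * s \<le> 0"
    by (simp add: algebra_simps)
  moreover have "0 < c * D - (c + 14) * \<epsilon>"
    using gap by (simp add: \<epsilon>_def)
  ultimately have "s \<le> 0"
    by (simp add: mult_le_0_iff)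
  moreover have "0 \<le> s"
    unfolding s_def by (intro sum_nonneg a0)
  ultimately have "s = 0" by simp
  then have "a i = 0" for i
    unfolding s_def using a0 by (subst (asm) sum_nonneg_eq_0_iff) auto
  then have "y i = m" for i
    by (simp add: a_def w_def)
  then show ?thesis by blast
qed

section \<open>Synchronization and the block model\<close>

text \<open>
  The diagonals of \<open>C\<close> and of \<open>\<kappa> z z\<^sup>T + M\<close> may differ, because \<open>1 - x\<^sub>i\<^sub>i = 0\<close> removes them from the
  second-order inequality.  This freedom is what makes the diagonal shift \<open>p I\<close> in the
  block model harmless.
\<close>

theorem synchronization_benign:
  fixes C M :: "real^'n^'n" and z :: "real^'n" and Y :: "real^'r^'n" and \<kappa> D :: real
  assumes C: "transpose C = C" and M: "transpose M = M"
    and crit: "second_order_critical C Y"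
    and z: "\<And>i. z $ i = 1 \<or> z $ i = -1"
    and CM: "\<And>i j. i \<noteq> j \<Longrightarrow> C $ i $ j = \<kappa> * (z $ i * z $ j) + M $ i $ j"
    and \<kappa>: "0 \<le> \<kappa>" and r: "3 < CARD('r)"
    and D: "\<And>i. D \<le> \<kappa> * real CARD('n) + z $ i * (M *v z) $ i"
    and gap: "(real CARD('r) + 11) / (real CARD('r) - 3) * op_norm M < D"
  shows "\<exists>u. norm u = 1 \<and> Y = outer z u"
proof -
  define y where "y i = z $ i *\<^sub>R Y $ i" for i
  define c where "c = real CARD('r) - 3"
  have c: "0 < c"
    using r by (simp add: c_def)
  note so = second_order_gram_inequality[OF C crit z y_def]
  have zz: "z $ i * z $ i = 1" for i
    using z[of i] by auto
  have "\<exists>m. \<forall>i. y i = m"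
  proof (rule gram_inequality_rigidity[OF z M \<kappa> c])
    show "norm (y i) = 1" for i
      by (rule so(1))
    show "D \<le> (\<Sum>j\<in>UNIV. \<kappa> + z $ i * z $ j * M $ i $ j)" for i
      using D[of i] by (simp add: sum.distrib matrix_vector_mult_def sum_distrib_left mult_ac)
    show "(c + 14) * op_norm M < c * D"
      using gap c by (simp add: c_def field_simps)
    have "(\<Sum>i\<in>UNIV. \<Sum>j\<in>UNIV. (\<kappa> + z $ i * z $ j * M $ i $ j) *
           ((1 - y i \<bullet> y j) * (c + (1 - y i \<bullet> y j))))
      = (\<Sum>i\<in>UNIV. \<Sum>j\<in>UNIV. z $ i * z $ j * C $ i $ j *
           ((1 - y i \<bullet> y j) * (real CARD('r) - 2 - y i \<bullet> y j)))"
    proof (intro sum.cong refl)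
      fix i j
      have "y i \<bullet> y i = 1"
        using so(1)[of i] by (simp add: norm_eq_1)
      moreover have "z $ i * z $ j * C $ i $ j = \<kappa> + z $ i * z $ j * M $ i $ j" if "i \<noteq> j"
        using z[of i] z[of j] CM[OF that] by auto
      ultimately show "(\<kappa> + z $ i * z $ j * M $ i $ j) * ((1 - y i \<bullet> y j) * (c + (1 - y i \<bullet> y j)))
        = z $ i * z $ j * C $ i $ j * ((1 - y i \<bullet> y j) * (real CARD('r) - 2 - y i \<bullet> y j))"
        by (cases "i = j") (simp_all add: c_def algebra_simps)
    qed
    then show "(\<Sum>i\<in>UNIV. \<Sum>j\<in>UNIV. (\<kappa> + z $ i * z $ j * M $ i $ j) *
           ((1 - y i \<bullet> y j) * (c + (1 - y i \<bullet> y j)))) \<le> 0"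
      using so(2) by simp
  qed
  then obtain u where u: "\<And>i. y i = u" by blast
  have "Y $ i = z $ i *\<^sub>R u" for i
    using u[of i] zz[of i] by (auto simp: y_def)
  then have "Y = outer z u"
    by (simp add: vec_eq_iff outer_def)
  moreover have "norm u = 1"
    using so(1) u by metis
  ultimately show ?thesis by blast
qed

theorem theorem4:
  fixes A C :: "real^'n^'n" and z :: "real^'n" and Y :: "real^'r^'n" and p q :: real
  assumes "even CARD('n)"
    and "\<forall>i. z $ i = 1 \<or> z $ i = -1"
    and "z \<bullet> 1 = 0"
    and "0 \<le> q" and "q < p" and "p \<le> 1"
    and "adjacency_matrix A"
    and "CARD('r) \<ge> 4"
    and "(C = A - (1 / (real CARD('n))\<^sup>2 * (A \<bullet> outer 1 1)) *\<^sub>R outer 1 1 \<and>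
          min_label_degree A z \<ge>
            (real CARD('r) + 11) / (real CARD('r) - 3) * (2 * op_norm (A - sbm_mean p q z) + p)
            + real CARD('n) * (p - q) / (real CARD('r) - 1))
       \<or> (C = A - ((p + q) / 2) *\<^sub>R outer 1 1 \<and>
          min_label_degree A z \<ge>
            (real CARD('r) + 11) / (real CARD('r) - 3) * op_norm (A - sbm_mean p q z)
            + real CARD('n) * (p - q) / (real CARD('r) - 1))"
    and "second_order_critical C Y"
  shows "\<exists>u :: real^'r. norm u = 1 \<and> Y = outer z u"
proof -
  define \<kappa> where "\<kappa> = (p - q) / 2"
  define R where "R = A - sbm_mean p q z"
  define \<mu> where "\<mu> = 1 / (real CARD('n))\<^sup>2 * (A \<bullet> outer 1 1)"
  define t where "t = (real CARD('r) + 11) / (real CARD('r) - 3)"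
  note z = assms(2)[rule_format]
  have n: "0 < real CARD('n)" and t: "0 < t"
    using assms(8) by (simp_all add: t_def)
  \<comment> \<open>This summand of the degree condition makes the gap strict.\<close>
  have slack: "0 < real CARD('n) * (p - q) / (real CARD('r) - 1)"
    using assms(5,8) n by simp
  have sz: "(\<Sum>j\<in>UNIV. z $ j) = 0"
    using assms(3) by (simp add: inner_vec_def)
  have Asym: "A $ i $ j = A $ j $ i" for i j
    using assms(7) unfolding adjacency_matrix_def by (metis transpose_def vec_lambda_beta)
  have Adiag: "A $ i $ i = 0" for i
    using assms(7) unfolding adjacency_matrix_def by blast
  have mean: "sbm_mean p q z $ i $ j = \<kappa> * (z $ i * z $ j) + (p + q) / 2 - (if i = j then p else 0)" for i j
    by (simp add: sbm_mean_def outer_def mat_def \<kappa>_def)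
  \<comment> \<open>Any multiple \<open>b\<close> of the all-ones matrix may be subtracted: what remains beyond the mean
    density joins the noise, and does not affect the row sums because \<open>z\<close> is balanced.\<close>
  have benign: "\<exists>u. norm u = 1 \<and> Y = outer z u"
    if C: "C = A - b *\<^sub>R outer 1 1"
      and gap: "t * op_norm (R + ((p + q) / 2 - b) *\<^sub>R outer 1 1) < min_label_degree A z" for b
  proof (rule synchronization_benign[OF _ _ assms(10) z])
    let ?M = "R + ((p + q) / 2 - b) *\<^sub>R outer 1 1"
    have M: "?M $ i $ j = A $ i $ j - b - \<kappa> * (z $ i * z $ j) + (if i = j then p else 0)" for i j
      by (simp add: R_def mean outer_def)
    show "transpose C = C"
      by (simp add: C transpose_def vec_eq_iff outer_def Asym)
    show "transpose ?M = ?M"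
      unfolding vec_eq_iff
      by (simp add: transpose_def R_def mean outer_def Asym mult_ac)
    show "C $ i $ j = \<kappa> * (z $ i * z $ j) + ?M $ i $ j" if "i \<noteq> j" for i j
      unfolding M using that by (simp add: C outer_def)
    show "0 \<le> \<kappa>" "3 < CARD('r)"
      using assms(5,8) by (simp_all add: \<kappa>_def)
    show "(real CARD('r) + 11) / (real CARD('r) - 3) * op_norm ?M < min_label_degree A z"
      using gap by (simp add: t_def)
    show "min_label_degree A z \<le> \<kappa> * real CARD('n) + z $ i * (?M *v z) $ i" for i
    proof -
      have zz: "z $ i * z $ i = 1" for i
        using z[of i] by auto
      have "(?M *v z) $ i = (\<Sum>j\<in>UNIV. A $ i $ j * z $ j - b * z $ j - \<kappa> * z $ i
          + (if i = j then p * z $ j else 0))"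
        unfolding matrix_vector_mult_def vec_lambda_beta M
      proof (rule sum.cong[OF refl])
        show "(A $ i $ j - b - \<kappa> * (z $ i * z $ j) + (if i = j then p else 0)) * z $ j
            = A $ i $ j * z $ j - b * z $ j - \<kappa> * z $ i + (if i = j then p * z $ j else 0)" for j
          using z[of j] by (auto simp: algebra_simps)
      qed
      also have "\<dots> = (\<Sum>j\<in>UNIV. A $ i $ j * z $ j) - real CARD('n) * (\<kappa> * z $ i) + p * z $ i"
        by (simp add: sum.distrib sum_subtractf sum_distrib_left[symmetric] sz)
      also have "(\<Sum>j\<in>UNIV. A $ i $ j * z $ j) = (\<Sum>j\<in>UNIV - {i}. A $ i $ j * z $ j)"
        by (subst sum.remove[of UNIV i]) (simp_all add: Adiag)
      finally have Mz: "(?M *v z) $ i = (\<Sum>j\<in>UNIV - {i}. A $ i $ j * z $ j)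
          - real CARD('n) * (\<kappa> * z $ i) + p * z $ i" .
      have "z $ i * (?M *v z) $ i = label_degree A z i
          - \<kappa> * real CARD('n) * (z $ i * z $ i) + p * (z $ i * z $ i)"
        unfolding Mz by (simp add: label_degree_def algebra_simps)
      then have "\<kappa> * real CARD('n) + z $ i * (?M *v z) $ i = label_degree A z i + p"
        unfolding zz by simp
      moreover have "min_label_degree A z \<le> label_degree A z i"
        unfolding min_label_degree_def by (rule Min_le) auto
      ultimately show ?thesis
        using assms(4,5) by linarith
    qed
  qed
  from assms(9) show ?thesis
  proof (elim disjE conjE)
    assume C: "C = A - (1 / (real CARD('n))\<^sup>2 * (A \<bullet> outer 1 1)) *\<^sub>R outer 1 1"
      and d: "min_label_degree A z \<ge>
            (real CARD('r) + 11) / (real CARD('r) - 3) * (2 * op_norm (A - sbm_mean p q z) + p)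
            + real CARD('n) * (p - q) / (real CARD('r) - 1)"
    \<comment> \<open>The empirical density misses \<open>(p + q)/2\<close> by the missing diagonal, \<open>p/n\<close>, and by the average
      \<open>\<eta>/n\<^sup>2\<close> of the noise.\<close>
    define \<eta> where "\<eta> = (1 :: real^'n) \<bullet> (R *v 1)"
    have \<eta>: "\<bar>\<eta>\<bar> \<le> op_norm R * real CARD('n)"
    proof -
      have n1: "norm (1 :: real^'n) * norm (1 :: real^'n) = real CARD('n)"
        by (simp add: norm_eq_sqrt_inner inner_vec_def)
      have "\<bar>\<eta>\<bar> \<le> norm (1 :: real^'n) * norm (R *v 1)"
        unfolding \<eta>_def by (rule Cauchy_Schwarz_ineq2)
      also have "\<dots> \<le> norm (1 :: real^'n) * (op_norm R * norm (1 :: real^'n))"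
        by (intro mult_left_mono op_norm_mult_le) simp
      also have "\<dots> = op_norm R * (norm (1 :: real^'n) * norm (1 :: real^'n))"
        by simp
      finally show ?thesis
        unfolding n1 .
    qed
    have "\<eta> = (\<Sum>i\<in>UNIV. \<Sum>j\<in>UNIV. A $ i $ j - \<kappa> * (z $ i * z $ j) - (p + q) / 2
        + (if i = j then p else 0))"
      by (simp add: \<eta>_def inner_vec_def matrix_vector_mult_def R_def mean algebra_simps)
    also have "\<dots> = A \<bullet> outer 1 1 - (p + q) / 2 * (real CARD('n))\<^sup>2 + p * real CARD('n)"
      by (simp add: sum.distrib sum_subtractf sum_distrib_left[symmetric] sz inner_vec_def
          outer_def power2_eq_square)
    finally have sumA: "A \<bullet> outer 1 1 = \<eta> + (p + q) / 2 * (real CARD('n))\<^sup>2 - p * real CARD('n)"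
      by linarith
    have "(p + q) / 2 - \<mu> = (p * real CARD('n) - \<eta>) / (real CARD('n))\<^sup>2"
      unfolding \<mu>_def sumA using n by (simp add: field_simps power2_eq_square)
    then have "\<bar>(p + q) / 2 - \<mu>\<bar> * real CARD('n) = \<bar>p * real CARD('n) - \<eta>\<bar> / real CARD('n)"
      using n by (simp add: power2_eq_square)
    also have "\<dots> \<le> (p * real CARD('n) + op_norm R * real CARD('n)) / real CARD('n)"
    proof (rule divide_right_mono)
      have "0 \<le> p * real CARD('n)"
        using assms(4,5) by simp
      then show "\<bar>p * real CARD('n) - \<eta>\<bar> \<le> p * real CARD('n) + op_norm R * real CARD('n)"
        using \<eta> by linarith
    qed simp
    also have "\<dots> = p + op_norm R"
      using n by (simp add: field_simps)
    finally have "op_norm (R + ((p + q) / 2 - \<mu>) *\<^sub>R outer 1 1) \<le> 2 * op_norm R + p"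
      using op_norm_triangle[of R "((p + q) / 2 - \<mu>) *\<^sub>R outer 1 1"]
        op_norm_outer_one_le[of "(p + q) / 2 - \<mu>", where 'n='n] by linarith
    then have "t * op_norm (R + ((p + q) / 2 - \<mu>) *\<^sub>R outer 1 1) \<le> t * (2 * op_norm R + p)"
      using t by simp
    also have "\<dots> < min_label_degree A z"
      using d slack by (simp add: t_def R_def)
    finally show ?thesis
      using benign[of \<mu>] C by (simp add: \<mu>_def)
  next
    assume C: "C = A - ((p + q) / 2) *\<^sub>R outer 1 1"
      and "min_label_degree A z \<ge>
            (real CARD('r) + 11) / (real CARD('r) - 3) * op_norm (A - sbm_mean p q z)
            + real CARD('n) * (p - q) / (real CARD('r) - 1)"
    then have "t * op_norm (R + ((p + q) / 2 - (p + q) / 2) *\<^sub>R outer 1 1) < min_label_degree A z"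
      using slack by (simp add: t_def R_def)
    then show ?thesis
      by (rule benign[OF C])
  qed
qed

end
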